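(* Let $A \in \mathbf{R}^{m\times N}$, $y\in\mathbf{R}^m$, $\lambda>0$, and $0<\mu<\|A\|_2^{-2}$. Let $\{x^{(n)}\}_{n\ge 0}\subset \mathbf{R}^N$ be a sequence generated by the half algorithm, i.e. $x^{(n+1)} = H_{\lambda\mu,\frac12}\big(x^{(n)}-\mu A^T(Ax^{(n)}-y)\big)$ for all $n\ge 0$, and assume that it converges to $x^*\in\mathbf{R}^N$. Let $I=\mathrm{supp}(x^* )$ and $e=\min_{i\in I}|x_i^*|$. Suppose that at least one of the following two conditions holds: (1) $\sigma_{\min}(A_I^TA_I)>0$ and $0<\lambda<8e^{3/2}\sigma_{\min}(A_I^TA_I)$; (2) $\sigma_{\min}(A_I^TA_I)>\frac{\|A\|_2^2}{4}$ and $\frac{1}{4\sigma_{\min}(A_I^TA_I)}<\mu<\|A\|_2^{-2}$. Then there exist a positive integer $n_0$ and a constant $\rho^*\in(0,1)$ such that for all $n>n_0$, $$\|x^{(n+1)}-x^*\|_2\le\rho^*\,\|x^{(n)}-x^*\|_2.$$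
   Context: $\|A\|_2$ is the spectral norm and $A^T$ the transpose of $A$. Half thresholding operator: for $z\in\mathbf{R}^N$, $H_{\lambda\mu,\frac12}(z)=(h_{\lambda\mu,\frac12}(z_1),\dots,h_{\lambda\mu,\frac12}(z_N))^T$, where for $u\in\mathbf{R}$, $h_{\lambda\mu,\frac12}(u)=f_{\lambda\mu,\frac12}(u)$ if $|u|>\frac{\sqrt[3]{54}}{4}(\lambda\mu)^{2/3}$ and $h_{\lambda\mu,\frac12}(u)=0$ otherwise, with $$f_{\lambda\mu,\frac12}(u)=\tfrac23 u\Big(1+\cos\big(\tfrac{2\pi}{3}-\tfrac23\phi_{\lambda\mu}(u)\big)\Big),\qquad \phi_{\lambda\mu}(u)=\arccos\Big(\tfrac{\lambda\mu}{8}\big(\tfrac{|u|}{3}\big)^{-3/2}\Big).$$ The initial point $x^{(0)}\in\mathbf{R}^N$ is arbitrary. $\mathrm{supp}(x)=\{i: x_i\ne 0\}$. For an index set $S$, $A_S$ is the submatrix of $A$ consisting of the columns indexed by $S$, and $\sigma_{\min}(A_S^TA_S)$ is the minimal singular value of $A_S^TA_S$. The definition of $e$ presupposes that $I$ is nonempty. *)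

theory Defs
  imports "HOL-Analysis.Analysis"
begin

definition spectral_norm :: "real^'n^'m \<Rightarrow> real" where
  "spectral_norm A = onorm ((*v) A)"

text \<open>The parameter \<open>t\<close> below stands for the product of \<open>\<lambda>\<close> and \<open>\<mu>\<close>.\<close>

definition half_phi :: "real \<Rightarrow> real \<Rightarrow> real" where
  "half_phi t u = arccos (t / 8 * (\<bar>u\<bar> / 3) powr (- (3 / 2)))"

definition half_f :: "real \<Rightarrow> real \<Rightarrow> real" where
  "half_f t u = 2 / 3 * u * (1 + cos (2 * pi / 3 - 2 / 3 * half_phi t u))"

definition half_h :: "real \<Rightarrow> real \<Rightarrow> real" where
  "half_h t u = (if \<bar>u\<bar> > root 3 54 / 4 * t powr (2 / 3) then half_f t u else 0)"

definition half_threshold :: "real \<Rightarrow> real^'n \<Rightarrow> real^'n" where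
  "half_threshold t z = (\<chi> i. half_h t (z $ i))"

definition supp :: "real^'n \<Rightarrow> 'n set" where
  "supp x = {i. x $ i \<noteq> 0}"

text \<open>
  For an index set \<open>S\<close>, the space of real vectors indexed by \<open>S\<close> is identified with the
  coordinate subspace of the vectors supported in \<open>S\<close>. Accordingly, a matrix whose columns (or
  rows) are indexed by \<open>S\<close> is represented by its extension by zero. In particular, the product
  of \<open>transpose (cols_submatrix A S)\<close> and \<open>cols_submatrix A S\<close> represents an \<open>S\<close> by \<open>S\<close> matrix.
\<close>

definition cols_submatrix :: "real^'n^'m \<Rightarrow> 'n set \<Rightarrow> real^'n^'m" where
  "cols_submatrix A S = (\<chi> i j. if j \<in> S then A $ i $ j else 0)"

text \<open>
  Singular values of the \<open>S\<close> by \<open>S\<close> matrix represented by \<open>M\<close>: the square roots of the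
  eigenvalues of \<open>transpose M ** M\<close>. Eigenvectors must be supported in \<open>S\<close>, so that the zero
  rows and columns outside \<open>S\<close> do not contribute a spurious singular value \<open>0\<close>.
\<close>

definition singular_values :: "'n set \<Rightarrow> real^'n^'n \<Rightarrow> real set" where
  "singular_values S M =
     {s. s \<ge> 0 \<and> (\<exists>v. v \<noteq> 0 \<and> supp v \<subseteq> S \<and> (transpose M ** M) *v v = s\<^sup>2 *\<^sub>R v)}"

definition sigma_min :: "'n set \<Rightarrow> real^'n^'n \<Rightarrow> real" where
  "sigma_min S M = Min (singular_values S M)"

definition sigma_min_gram :: "real^'n^'m \<Rightarrow> 'n set \<Rightarrow> real" where
  "sigma_min_gram A S = sigma_min S (transpose (cols_submatrix A S) ** cols_submatrix A S)"

end

theory Submission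
  imports Defs
begin

text \<open>
  The nonzero values \<open>x\<close> of the half thresholding function satisfy
  \<open>x + t sgn x / (4 sqrt \<bar>x\<bar>) = u\<close> (the optimality condition, by the trigonometric solution of
  a cubic) and \<open>\<bar>x\<bar>\<^sup>3 \<ge> t\<^sup>2 / 4\<close>. Because of this gap, the supports and signs of the iterates
  are eventually those of the limit. From then on the error passes through the symmetric positive
  semidefinite map \<open>1 - \<mu> A\<^sub>I\<^sup>T A\<^sub>I\<close>, which contracts by \<open>1 - \<mu> \<sigma>\<close>, and through the inverse of
  the optimality map, which expands by at most \<open>1 / (1 - t / (8 r\<^sup>3))\<close> on \<open>\<bar>x\<bar> \<ge> r\<^sup>2\<close>. The first
  condition makes the product smaller than \<open>1\<close> with \<open>r\<^sup>2\<close> slightly below \<open>e\<close>, the second one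
  with \<open>r\<^sup>3 = t / 2\<close>.
\<close>

subsection \<open>The half thresholding function\<close>

text \<open>For \<open>x \<noteq> 0\<close>, the equation \<open>half_resolvent t x = u\<close> is
  the stationarity condition of \<open>(x - u)\<^sup>2 + t * sqrt \<bar>x\<bar>\<close> in
  \<open>x\<close>.\<close>

definition half_resolvent :: "real \<Rightarrow> real \<Rightarrow> real" where
  "half_resolvent t x = x + t * sgn x / (4 * sqrt \<bar>x\<bar>)"

lemma half_threshold_cubed:
  assumes "t > 0"
  shows "(root 3 54 / 4 * t powr (2 / 3)) ^ 3 = 27 / 32 * t\<^sup>2"
proof -
  have "root 3 54 ^ 3 = (54::real)" by simp
  moreover have "(t powr (2 / 3)) ^ 3 = t\<^sup>2"
    using assms by (simp add: powr_power)
  ultimately show ?thesis by (simp add: power_mult_distrib power_divide)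
qed

lemma powr_three_halves:
  fixes a :: real
  assumes "a \<ge> 0"
  shows "a powr (3 / 2) = sqrt a ^ 3"
proof (cases "a = 0")
  case False
  then show ?thesis
    using assms by (simp add: powr_half_sqrt[symmetric] powr_powr flip: powr_realpow)
qed simp

text \<open>With \<open>r = sqrt (half_f t u)\<close> the optimality condition becomes the cubic
  \<open>r ^ 3 - u * r + t / 4 = 0\<close>, solved by \<open>r = 2 * s * cos \<theta>\<close> and
  the triple angle formula. Above the threshold \<open>\<theta> \<le> pi / 4\<close>, hence
  \<open>half_f t u \<ge> 2 / 3 * u\<close>, which gives the gap.\<close>

lemma half_f_pos:
  assumes "t > 0" "u > 0" and u: "27 / 32 * t\<^sup>2 < u ^ 3"
  shows "half_f t u > 0" "t\<^sup>2 / 4 \<le> half_f t u ^ 3"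
    "half_f t u + t / (4 * sqrt (half_f t u)) = u"
proof -
  define s where "s = sqrt (u / 3)"
  \<comment> \<open>\<open>w\<close> is the argument of \<open>arccos\<close> in
    \<open>half_phi\<close>, and \<open>\<theta>\<close> is half of the angle in
    \<open>half_f\<close>, so that \<open>1 + cos (2 * \<theta>)\<close> becomes a square.\<close>
  define w where "w = t / (8 * s ^ 3)"
  define \<theta> where "\<theta> = pi / 3 - arccos w / 3"
  have s: "s > 0" "s\<^sup>2 = u / 3" using assms by (auto simp: s_def)
  have w0: "w > 0" using assms s by (simp add: w_def)
  have s6: "(s ^ 3)\<^sup>2 = u ^ 3 / 27"
  proof -
    have "(s ^ 3)\<^sup>2 = (s\<^sup>2) ^ 3" by (simp flip: power_mult)
    then show ?thesis using s by (simp add: power_divide)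
  qed
  have "w\<^sup>2 = t\<^sup>2 / (64 * (s ^ 3)\<^sup>2)" by (simp add: w_def power_divide power_mult_distrib)
  \<comment> \<open>The threshold on \<open>u\<close> enters here: it amounts to
    \<open>w\<^sup>2 < 1 / 2\<close>.\<close>
  also have "\<dots> \<le> 1 / 2" using u assms unfolding s6 by (simp add: field_simps)
  finally have "w\<^sup>2 \<le> (sqrt 2 / 2)\<^sup>2" by (simp add: power_divide)
  then have w1: "w \<le> sqrt 2 / 2"
    by (rule power2_le_imp_le) simp
  have "sqrt 2 / 2 \<le> (1::real)" using sqrt2_less_2 by simp
  then have w2: "w \<le> 1" using w1 by linarith
  have ac: "arccos (sqrt 2 / 2) = pi / 4"
    using arccos_cos[of "pi / 4"] by (simp add: cos_45)
  have "arccos w \<ge> pi / 4"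
    using arccos_le_arccos[of w "sqrt 2 / 2"] w0 w1 \<open>sqrt 2 / 2 \<le> 1\<close> ac by simp
  moreover have "arccos w \<le> pi" using arccos_ubound w0 w2 by simp
  ultimately have th: "0 \<le> \<theta>" "\<theta> \<le> pi / 4" by (auto simp: \<theta>_def)
  have c: "cos \<theta> \<ge> sqrt 2 / 2"
    using cos_monotone_0_pi_le[of \<theta> "pi / 4"] th by (simp add: cos_45)
  have "(u / 3) powr (- (3 / 2)) = 1 / s ^ 3"
    using powr_three_halves[of "u / 3"] assms(2)
    unfolding powr_minus_divide s_def by simp
  then have phi: "half_phi t u = arccos w"
    using assms by (simp add: half_phi_def w_def)
  have "2 * pi / 3 - 2 / 3 * half_phi t u = 2 * \<theta>" by (simp add: phi \<theta>_def)
  then have "half_f t u = 4 / 3 * u * (cos \<theta>)\<^sup>2"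
    by (simp add: half_f_def cos_double_cos)
  then have f: "half_f t u = (2 * s * cos \<theta>)\<^sup>2" by (simp add: power_mult_distrib s(2))
  have cpos: "cos \<theta> > 0" using c by (meson less_le_trans divide_pos_pos real_sqrt_gt_zero zero_less_numeral)
  show pos: "half_f t u > 0" using f s cpos by simp
  have "(sqrt 2 / 2)\<^sup>2 \<le> (cos \<theta>)\<^sup>2" using c by (intro power_mono) auto
  then have "1 / 2 \<le> (cos \<theta>)\<^sup>2" by (simp add: power_divide)
  then have "2 / 3 * u \<le> half_f t u" using f s \<open>u > 0\<close> by (simp add: power_mult_distrib field_simps)
  then have "(2 / 3 * u) ^ 3 \<le> half_f t u ^ 3" using \<open>u > 0\<close> by (intro power_mono) auto
  moreover have "t\<^sup>2 / 4 \<le> (2 / 3 * u) ^ 3" using u by (simp add: power_mult_distrib power_divide)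
  ultimately show "t\<^sup>2 / 4 \<le> half_f t u ^ 3" by linarith
  have "cos (3 * \<theta>) = cos (pi - arccos w)" by (simp add: \<theta>_def algebra_simps)
  also have "\<dots> = - w" using w0 w2 by simp
  finally have tc: "4 * cos \<theta> ^ 3 - 3 * cos \<theta> = - w" by (simp add: cos_treble_cos)
  define r where "r = 2 * s * cos \<theta>"
  have r: "r > 0" "half_f t u = r\<^sup>2" using s cpos f by (auto simp: r_def)
  have "r ^ 3 - u * r = 2 * s ^ 3 * (4 * cos \<theta> ^ 3 - 3 * cos \<theta>)"
  proof -
    have u3: "u = 3 * s\<^sup>2" using s by simp
    show ?thesis unfolding r_def u3 by algebra
  qed
  also have "\<dots> = - t / 4" using s unfolding tc by (simp add: w_def)
  finally have "r ^ 3 + t / 4 = u * r" by simp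
  then have "r\<^sup>2 + t / (4 * r) = u"
    using r by (simp add: field_simps power2_eq_square power3_eq_cube)
  then show "half_f t u + t / (4 * sqrt (half_f t u)) = u" using r by simp
qed

lemma half_f_minus: "half_f t (- u) = - half_f t u"
  by (simp add: half_f_def half_phi_def)

text \<open>Oddness of \<open>half_f\<close> reduces both claims to \<open>\<bar>u\<bar>\<close>.
  The second one allows thresholding to be studied through its explicit inverse.\<close>

lemma half_h_nonzero:
  assumes "t > 0" and "half_h t u \<noteq> 0"
  shows "t\<^sup>2 / 4 \<le> \<bar>half_h t u\<bar> ^ 3" "half_resolvent t (half_h t u) = u"
proof -
  let ?T = "root 3 54 / 4 * t powr (2 / 3)"
  have T: "?T < \<bar>u\<bar>" and h: "half_h t u = half_f t u"
    using assms by (auto simp: half_h_def split: if_splits)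
  have T0: "?T \<ge> 0" by simp
  then have u0: "\<bar>u\<bar> > 0" using T by linarith
  have "?T ^ 3 < \<bar>u\<bar> ^ 3" using T T0 by (intro power_strict_mono) auto
  then have "27 / 32 * t\<^sup>2 < \<bar>u\<bar> ^ 3" using half_threshold_cubed[OF assms(1)] by simp
  note * = half_f_pos[OF assms(1) u0 this]
  define F where "F = half_f t \<bar>u\<bar>"
  have F: "F > 0" "half_h t u = sgn u * F"
    using *(1) u0 by (cases "u > 0"; simp add: h F_def half_f_minus)+
  show "t\<^sup>2 / 4 \<le> \<bar>half_h t u\<bar> ^ 3"
    using *(2) F u0 by (simp add: abs_mult abs_sgn_eq flip: F_def)
  have "half_resolvent t (half_h t u) = sgn u * (F + t / (4 * sqrt F))"
    using F u0 by (simp add: half_resolvent_def abs_mult abs_sgn_eq sgn_mult algebra_simps)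
  also have "\<dots> = u" using *(3) by (simp add: sgn_mult_abs flip: F_def)
  finally show "half_resolvent t (half_h t u) = u" .
qed

text \<open>With \<open>p = sqrt \<bar>a\<bar>\<close> and \<open>q = sqrt \<bar>b\<bar>\<close>,
  the difference factors through \<open>p\<^sup>2 - q\<^sup>2\<close>, and
  \<open>p * q * (p + q) \<ge> 2 * r ^ 3\<close>. The constant is the derivative of
  \<open>half_resolvent t\<close> at \<open>r\<^sup>2\<close>.\<close>

lemma half_resolvent_expanding:
  assumes "t \<ge> 0" "r > 0" "r\<^sup>2 \<le> \<bar>a\<bar>" "r\<^sup>2 \<le> \<bar>b\<bar>" "sgn a = sgn b"
  shows "(1 - t / (8 * r ^ 3)) * \<bar>a - b\<bar> \<le> \<bar>half_resolvent t a - half_resolvent t b\<bar>"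
proof -
  define p where "p = sqrt \<bar>a\<bar>"
  define q where "q = sqrt \<bar>b\<bar>"
  have p: "p \<ge> r" and q: "q \<ge> r" unfolding p_def q_def
    using assms by (auto intro!: real_le_rsqrt)
  then have pq: "p > 0" "q > 0" using assms by auto
  define \<sigma> where "\<sigma> = sgn a"
  have "a \<noteq> 0" using assms by auto
  then have sg: "\<bar>\<sigma>\<bar> = 1" by (simp add: \<sigma>_def abs_sgn_eq)
  have p2: "p\<^sup>2 = \<bar>a\<bar>" and q2: "q\<^sup>2 = \<bar>b\<bar>" by (simp_all add: p_def q_def)
  have ab: "a = \<sigma> * p\<^sup>2" "b = \<sigma> * q\<^sup>2"
    unfolding p2 q2 by (simp_all add: \<sigma>_def sgn_mult_abs) (simp add: assms sgn_mult_abs)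
  have "half_resolvent t a = \<sigma> * (p\<^sup>2 + t / (4 * p))"
    unfolding half_resolvent_def \<sigma>_def[symmetric] p_def[symmetric]
    by (subst ab(1)) (simp add: algebra_simps)
  moreover have "half_resolvent t b = \<sigma> * (q\<^sup>2 + t / (4 * q))"
    unfolding half_resolvent_def assms(5)[symmetric] \<sigma>_def[symmetric] q_def[symmetric]
    by (subst ab(2)) (simp add: algebra_simps)
  ultimately have "half_resolvent t a - half_resolvent t b
      = \<sigma> * ((p\<^sup>2 + t / (4 * p)) - (q\<^sup>2 + t / (4 * q)))" by (simp add: algebra_simps)
  also have "(p\<^sup>2 + t / (4 * p)) - (q\<^sup>2 + t / (4 * q))
      = (p\<^sup>2 - q\<^sup>2) * (1 - t / (4 * (p * q * (p + q))))"
  proof -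
    have "t / (4 * p) - t / (4 * q) = - ((p\<^sup>2 - q\<^sup>2) * (t / (4 * (p * q * (p + q)))))"
    proof -
      have "p + q \<noteq> 0" using pq by auto
      moreover have "p\<^sup>2 - q\<^sup>2 = (p - q) * (p + q)" by algebra
      ultimately show ?thesis using pq by (simp add: divide_simps) (simp add: algebra_simps)
    qed
    moreover have "(p\<^sup>2 + t / (4 * p)) - (q\<^sup>2 + t / (4 * q))
        = (p\<^sup>2 - q\<^sup>2) + (t / (4 * p) - t / (4 * q))" by simp
    ultimately show ?thesis by (simp only:) (simp only: right_diff_distrib mult_1_right add_uminus_conv_diff)
  qed
  finally have "\<bar>half_resolvent t a - half_resolvent t b\<bar>
      = \<bar>p\<^sup>2 - q\<^sup>2\<bar> * \<bar>1 - t / (4 * (p * q * (p + q)))\<bar>" using sg by (simp add: abs_mult)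
  moreover have "\<bar>a - b\<bar> = \<bar>p\<^sup>2 - q\<^sup>2\<bar>"
  proof -
    have "a - b = \<sigma> * (p\<^sup>2 - q\<^sup>2)" using ab by (simp add: algebra_simps)
    then show ?thesis using sg by (simp add: abs_mult)
  qed
  moreover have "1 - t / (8 * r ^ 3) \<le> \<bar>1 - t / (4 * (p * q * (p + q)))\<bar>"
  proof -
    have "r * r * (r + r) \<le> p * q * (p + q)"
      using p q assms pq by (intro mult_mono add_mono) auto
    then have "8 * r ^ 3 \<le> 4 * (p * q * (p + q))" by (simp add: power3_eq_cube)
    then have "t / (4 * (p * q * (p + q))) \<le> t / (8 * r ^ 3)"
      using assms pq by (intro divide_left_mono) auto
    then show ?thesis by linarith
  qed
  ultimately show ?thesis by (simp add: mult.commute mult_left_mono)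
qed

lemma tendsto_half_resolvent:
  assumes "(f \<longlongrightarrow> a) F" "a \<noteq> 0"
  shows "((\<lambda>n. half_resolvent t (f n)) \<longlongrightarrow> half_resolvent t a) F"
  unfolding half_resolvent_def using assms by (intro tendsto_intros) auto

subsection \<open>Symmetric positive semidefinite maps\<close>

text \<open>The form is nonnegative along the line \<open>v + k *\<^sub>R w\<close>, so this
  quadratic in \<open>k\<close> has no positive discriminant. As the form is only semidefinite, a
  vanishing leading coefficient is a separate case.\<close>

lemma psd_Cauchy_Schwarz:
  fixes f :: "'a::real_inner \<Rightarrow> 'a"
  assumes f: "linear f" and S: "subspace S"
    and sym: "\<And>v w. v \<in> S \<Longrightarrow> w \<in> S \<Longrightarrow> f v \<bullet> w = v \<bullet> f w"
    and psd: "\<And>v. v \<in> S \<Longrightarrow> 0 \<le> f v \<bullet> v"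
    and v: "v \<in> S" and w: "w \<in> S"
  shows "(f v \<bullet> w)\<^sup>2 \<le> (f v \<bullet> v) * (f w \<bullet> w)"
proof -
  define a b c where "a = f v \<bullet> v" and "b = f v \<bullet> w" and "c = f w \<bullet> w"
  have quad: "0 \<le> a + 2 * k * b + k\<^sup>2 * c" for k
  proof -
    have "v + k *\<^sub>R w \<in> S" using S v w by (simp add: subspace_add subspace_scale)
    then have "0 \<le> f (v + k *\<^sub>R w) \<bullet> (v + k *\<^sub>R w)" by (rule psd)
    also have "\<dots> = a + 2 * k * b + k\<^sup>2 * c"
      using sym[OF v w] by (simp add: a_def b_def c_def linear_add[OF f] linear_scale[OF f]
          inner_add_left inner_add_right power2_eq_square inner_commute algebra_simps)
    finally show ?thesis .
  qed
  have "c \<ge> 0" unfolding c_def by (rule psd[OF w])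
  have "b\<^sup>2 \<le> a * c"
  proof (cases "c = 0")
    case True
    have "b = 0"
    proof (rule ccontr)
      assume "b \<noteq> 0"
      \<comment> \<open>For \<open>c = 0\<close> the quadratic is affine in \<open>k\<close>, and
        this \<open>k\<close> gives it the value \<open>-1\<close>.\<close>
      then show False using quad[of "- (a + 1) / (2 * b)"] True by (simp add: field_simps)
    qed
    then show ?thesis using True by simp
  next
    case False
    then have "c > 0" using \<open>c \<ge> 0\<close> by simp
    then show ?thesis using quad[of "- b / c"]
      by (simp add: power_divide field_simps power2_eq_square)
  qed
  then show ?thesis by (simp add: a_def b_def c_def)
qed

text \<open>Cauchy-Schwarz for the pair \<open>v\<close>, \<open>f v\<close> turns a bound on the
  quadratic form into a bound on the norm.\<close>

lemma psd_norm_bound: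
  fixes f :: "'a::real_inner \<Rightarrow> 'a"
  assumes f: "linear f" and S: "subspace S"
    and sym: "\<And>v w. v \<in> S \<Longrightarrow> w \<in> S \<Longrightarrow> f v \<bullet> w = v \<bullet> f w"
    and psd: "\<And>v. v \<in> S \<Longrightarrow> 0 \<le> f v \<bullet> v"
    and inv: "\<And>v. v \<in> S \<Longrightarrow> f v \<in> S"
    and bound: "\<And>v. v \<in> S \<Longrightarrow> f v \<bullet> v \<le> k * (norm v)\<^sup>2"
    and k: "k \<ge> 0" and v: "v \<in> S"
  shows "norm (f v) \<le> k * norm v"
proof (cases "f v = 0")
  case False
  have "((norm (f v))\<^sup>2)\<^sup>2 = (f v \<bullet> f v)\<^sup>2" by (simp add: power2_norm_eq_inner)
  also have "\<dots> \<le> (f v \<bullet> v) * (f (f v) \<bullet> f v)"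
    by (rule psd_Cauchy_Schwarz[OF f S sym psd v inv[OF v]])
  also have "\<dots> \<le> (k * (norm v)\<^sup>2) * (k * (norm (f v))\<^sup>2)"
    using k by (intro mult_mono bound psd inv v) auto
  also have "\<dots> = (k * norm v)\<^sup>2 * (norm (f v))\<^sup>2" by (simp add: power2_eq_square)
  finally have "(norm (f v))\<^sup>2 \<le> (k * norm v)\<^sup>2"
    using False by (simp add: power2_eq_square)
  then show ?thesis using k by (intro power2_le_imp_le[of "norm (f v)"]) auto
qed (use k in auto)

subsection \<open>The minimal singular value of a Gram matrix\<close>

lemma subspace_supp: "subspace {v :: real^'n. supp v \<subseteq> S}"
proof -
  have "{v :: real^'n. supp v \<subseteq> S} = {v. \<forall>i. i \<notin> S \<longrightarrow> v $ i = 0}"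
    by (auto simp: supp_def)
  then show ?thesis by (simp add: subspace_def)
qed

lemma matrix_vector_mult_cols_submatrix:
  assumes "supp v \<subseteq> S"
  shows "cols_submatrix A S *v v = A *v v"
  using assms by (auto simp: vec_eq_iff matrix_vector_mult_def cols_submatrix_def supp_def
      intro!: sum.cong)

lemma transpose_cols_submatrix_nth:
  "(transpose (cols_submatrix A S) *v w) $ i = (if i \<in> S then (transpose A *v w) $ i else 0)"
  by (simp add: matrix_vector_mult_def cols_submatrix_def transpose_def)

lemma inner_gram:
  fixes B :: "real^'n^'m"
  shows "(transpose B *v (B *v v)) \<bullet> w = (B *v v) \<bullet> (B *v w)"
    and "w \<bullet> (transpose B *v (B *v v)) = (B *v w) \<bullet> (B *v v)"
proof -
  show *: "(transpose B *v (B *v v)) \<bullet> w = (B *v v) \<bullet> (B *v w)" for v w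
    by (simp add: dot_lmul_matrix)
  show "w \<bullet> (transpose B *v (B *v v)) = (B *v w) \<bullet> (B *v v)"
    by (metis * inner_commute)
qed

declare transpose_matrix_vector [simp del]

text \<open>Eigenvectors of a symmetric matrix for distinct eigenvalues are orthogonal, and a
  pairwise orthogonal set is finite here. Finiteness gives \<open>Min\<close> in
  \<open>sigma_min\<close> its meaning.\<close>

lemma finite_singular_values: "finite (singular_values S (M :: real^'n^'n))"
proof -
  define P where "P = (\<lambda>s v. v \<noteq> 0 \<and> (transpose M ** M) *v v = s\<^sup>2 *\<^sub>R v)"
  define V where "V = (\<lambda>s. SOME v. P s v)"
  have V: "P s (V s)" if "s \<in> singular_values S M" for s
    unfolding V_def using that by (intro someI_ex[of "P s"]) (auto simp: singular_values_def P_def)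
  have orth: "V s \<bullet> V s' = 0"
    if "s \<in> singular_values S M" "s' \<in> singular_values S M" "s \<noteq> s'" for s s'
  proof -
    let ?v = "V s" and ?w = "V s'"
    have "s\<^sup>2 * (?v \<bullet> ?w) = (transpose M *v (M *v ?v)) \<bullet> ?w"
      using V[OF that(1)] by (simp add: P_def matrix_vector_mul_assoc)
    also have "\<dots> = (transpose M *v (M *v ?w)) \<bullet> ?v" 
      unfolding inner_gram by (rule inner_commute)
    also have "\<dots> = s'\<^sup>2 * (?v \<bullet> ?w)"
      using V[OF that(2)] by (simp add: P_def matrix_vector_mul_assoc inner_commute)
    finally have "s\<^sup>2 * (?v \<bullet> ?w) = s'\<^sup>2 * (?v \<bullet> ?w)" .
    moreover have "s\<^sup>2 \<noteq> s'\<^sup>2" using that by (auto simp: singular_values_def)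
    ultimately show ?thesis by simp
  qed
  have nz: "V s \<noteq> 0" if "s \<in> singular_values S M" for s
    using V[OF that] by (simp add: P_def)
  have "inj_on V (singular_values S M)"
    by (rule inj_onI) (metis orth nz inner_eq_zero_iff)
  moreover have "pairwise orthogonal (V ` singular_values S M)"
    by (auto simp: pairwise_def orthogonal_def intro: orth)
  ultimately show ?thesis
    using pairwise_orthogonal_imp_finite finite_imageD by blast
qed

text \<open>
  A minimiser of the Rayleigh quotient is an eigenvector of the Gram matrix by the equality case
  of the Cauchy-Schwarz inequality, so the minimum is one of the singular values.
\<close>

lemma sigma_min_gram_le:
  fixes A :: "real^'n^'m"
  assumes d: "supp d \<subseteq> S"
  shows "sigma_min_gram A S * (norm d)\<^sup>2 \<le> (norm (A *v d))\<^sup>2"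
proof (cases "d = 0")
  case False
  define B where "B = cols_submatrix A S"
  define V where "V = {v :: real^'n. supp v \<subseteq> S}"
  define K where "K = V \<inter> sphere 0 1"
  have V: "subspace V" unfolding V_def by (rule subspace_supp)
  have "compact K" unfolding K_def
    by (intro closed_Int_compact closed_subspace V compact_sphere)
  moreover have unit: "(1 / norm w) *\<^sub>R w \<in> K" if "w \<in> V" "w \<noteq> 0" for w
    using that V by (simp add: K_def subspace_scale)
  have "d \<in> V" using d by (simp add: V_def)
  then have "K \<noteq> {}" using unit[OF _ False] by auto
  moreover have "continuous_on K (\<lambda>v. (norm (B *v v))\<^sup>2)"
    by (intro continuous_intros matrix_vector_mult_linear_continuous_on)
  ultimately obtain v where v: "v \<in> K" and
    min: "\<And>w. w \<in> K \<Longrightarrow> (norm (B *v v))\<^sup>2 \<le> (norm (B *v w))\<^sup>2"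
    using continuous_attains_inf[of K "\<lambda>v. (norm (B *v v))\<^sup>2"] by auto
  define l where "l = (norm (B *v v))\<^sup>2"
  have vV: "v \<in> V" and nv: "norm v = 1" using v by (auto simp: K_def)
  have ray: "l * (norm w)\<^sup>2 \<le> (norm (B *v w))\<^sup>2" if "w \<in> V" for w
  proof (cases "w = 0")
    case w0: False
    have "l \<le> (norm (B *v ((1 / norm w) *\<^sub>R w)))\<^sup>2"
      unfolding l_def by (rule min[OF unit[OF that w0]])
    then show ?thesis using w0
      by (simp add: matrix_vector_mult_scaleR power_divide field_simps)
  qed simp
  \<comment> \<open>By \<open>ray\<close> the form of \<open>f\<close> is nonnegative on
    \<open>V\<close>, and it vanishes at \<open>v\<close>. Cauchy-Schwarz for \<open>v\<close> and
    \<open>f v\<close> then forces \<open>f v = 0\<close>.\<close>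
  define f where "f = (\<lambda>w. transpose B *v (B *v w) - l *\<^sub>R w)"
  have lin: "linear f"
    by (rule linearI) (simp_all add: f_def matrix_vector_right_distrib
        matrix_vector_mult_scaleR algebra_simps)
  have fV: "f w \<in> V" if "w \<in> V" for w
    using that by (auto simp: V_def supp_def f_def B_def transpose_cols_submatrix_nth)
  have sym: "f a \<bullet> b = a \<bullet> f b" for a b
    by (simp add: f_def inner_diff_left inner_diff_right inner_gram)
  have quad: "f w \<bullet> w = (norm (B *v w))\<^sup>2 - l * (norm w)\<^sup>2" for w
    by (simp add: f_def inner_diff_left inner_gram power2_norm_eq_inner)
  have "(f v \<bullet> f v)\<^sup>2 \<le> (f v \<bullet> v) * (f (f v) \<bullet> f v)"
    by (rule psd_Cauchy_Schwarz[OF lin V sym _ vV fV[OF vV]]) (simp add: quad ray)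
  also have "f v \<bullet> v = 0" by (simp add: quad nv l_def)
  finally have "f v = 0" by simp
  then have ev: "transpose B *v (B *v v) = l *\<^sub>R v" by (simp add: f_def)
  define G where "G = transpose B ** B"
  have G: "G *v v = l *\<^sub>R v" using ev by (simp add: G_def matrix_vector_mul_assoc)
  \<comment> \<open>Singular values are defined through \<open>transpose G ** G\<close>, which for
    symmetric \<open>G\<close> is its square; since \<open>l \<ge> 0\<close>, the eigenvalue
    \<open>l\<close> is itself a singular value.\<close>
  have "transpose G = G" by (simp add: G_def matrix_transpose_mul)
  then have "(transpose G ** G) *v v = l\<^sup>2 *\<^sub>R v"
    by (simp add: G matrix_vector_mult_scaleR power2_eq_square flip: matrix_vector_mul_assoc)
  moreover have "v \<noteq> 0" using nv by auto
  ultimately have "l \<in> singular_values S G"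
    using vV by (auto simp: singular_values_def l_def V_def)
  then have "sigma_min_gram A S \<le> l"
    unfolding sigma_min_gram_def sigma_min_def G_def B_def
    by (intro Min_le finite_singular_values)
  then have "sigma_min_gram A S * (norm d)\<^sup>2 \<le> l * (norm d)\<^sup>2" by (simp add: mult_right_mono)
  also have "\<dots> \<le> (norm (B *v d))\<^sup>2" by (rule ray[OF \<open>d \<in> V\<close>])
  finally show ?thesis by (simp add: B_def matrix_vector_mult_cols_submatrix[OF d])
qed simp

text \<open>On vectors supported in \<open>S\<close> the step is symmetric. Its form is nonnegative
  by the bound on \<open>mu\<close> and at most \<open>1 - mu * sigma_min_gram A S\<close> times the
  squared norm, so \<open>psd_norm_bound\<close> applies.\<close>

lemma gradient_step_contraction:
  fixes A :: "real^'n^'m"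
  assumes mu: "0 < mu" "mu < 1 / (spectral_norm A)\<^sup>2" and S: "S \<noteq> {}"
  defines "f \<equiv> \<lambda>d. d - mu *\<^sub>R (transpose (cols_submatrix A S) *v (A *v d))"
  shows "mu * sigma_min_gram A S \<le> 1"
    and "supp d \<subseteq> S \<Longrightarrow> norm (f d) \<le> (1 - mu * sigma_min_gram A S) * norm d"
proof -
  define B where "B = cols_submatrix A S"
  define V where "V = {v :: real^'n. supp v \<subseteq> S}"
  define g where "g = (\<lambda>d. d - mu *\<^sub>R (transpose B *v (B *v d)))"
  have V: "subspace V" unfolding V_def by (rule subspace_supp)
  have BA: "B *v v = A *v v" if "v \<in> V" for v
    using that by (simp add: B_def V_def matrix_vector_mult_cols_submatrix)
  have lin: "linear g"
    by (rule linearI) (simp_all add: g_def matrix_vector_right_distrib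
        matrix_vector_mult_scaleR algebra_simps)
  have gV: "g w \<in> V" if "w \<in> V" for w
    using that by (auto simp: V_def supp_def g_def B_def transpose_cols_submatrix_nth)
  have sym: "g a \<bullet> b = a \<bullet> g b" for a b
    by (simp add: g_def inner_diff_left inner_diff_right inner_gram)
  have quad: "g w \<bullet> w = (norm w)\<^sup>2 - mu * (norm (B *v w))\<^sup>2" for w
    by (simp add: g_def inner_diff_left inner_gram power2_norm_eq_inner)
  \<comment> \<open>A zero norm would make the upper bound on \<open>mu\<close> equal to
    \<open>1 / 0 = 0\<close>.\<close>
  have "spectral_norm A \<noteq> 0" using mu by auto
  then have muA: "mu * (spectral_norm A)\<^sup>2 \<le> 1" using mu by (simp add: field_simps)
  have up: "mu * (norm (A *v w))\<^sup>2 \<le> (norm w)\<^sup>2" for w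
  proof -
    have "norm (A *v w) \<le> spectral_norm A * norm w"
      unfolding spectral_norm_def by (rule onorm) (rule matrix_vector_mul_bounded_linear)
    then have "(norm (A *v w))\<^sup>2 \<le> (spectral_norm A * norm w)\<^sup>2" by (intro power_mono) auto
    then have "mu * (norm (A *v w))\<^sup>2 \<le> mu * (spectral_norm A * norm w)\<^sup>2" using mu by simp
    also have "\<dots> = (mu * (spectral_norm A)\<^sup>2) * (norm w)\<^sup>2" by (simp add: power_mult_distrib)
    also have "\<dots> \<le> 1 * (norm w)\<^sup>2" using muA by (intro mult_right_mono) auto
    finally show ?thesis by simp
  qed
  have low: "mu * sigma_min_gram A S * (norm w)\<^sup>2 \<le> mu * (norm (A *v w))\<^sup>2" if "w \<in> V" for w
    using sigma_min_gram_le[of w S A] that mu by (simp add: V_def mult.assoc)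
  \<comment> \<open>A unit vector in \<open>V\<close> compares the lower and the upper bound on the
    form.\<close>
  obtain i where "i \<in> S" using S by auto
  then have "axis i 1 \<in> V" by (auto simp: V_def supp_def axis_def)
  then show le1: "mu * sigma_min_gram A S \<le> 1"
    using low[of "axis i 1"] up[of "axis i 1"] by simp
  show "norm (f d) \<le> (1 - mu * sigma_min_gram A S) * norm d" if "supp d \<subseteq> S"
  proof -
    have dV: "d \<in> V" using that by (simp add: V_def)
    have "norm (g d) \<le> (1 - mu * sigma_min_gram A S) * norm d"
    proof (rule psd_norm_bound[OF lin V sym _ gV _ _ dV])
      show "0 \<le> g v \<bullet> v" if "v \<in> V" for v using up[of v] BA[OF that] by (simp add: quad)
      show "g v \<bullet> v \<le> (1 - mu * sigma_min_gram A S) * (norm v)\<^sup>2" if "v \<in> V" for v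
        using low[OF that] BA[OF that] by (simp add: quad algebra_simps)
    qed (use le1 in auto)
    then show ?thesis by (simp add: f_def g_def BA[OF dV] flip: B_def)
  qed
qed

subsection \<open>Eventual linear convergence\<close>

theorem theorem3:
  fixes A :: "real^'n^'m" and y :: "real^'m" and lam mu e :: real
    and x :: "nat \<Rightarrow> real^'n" and xs :: "real^'n" and I :: "'n set"
  assumes "lam > 0"
    and "0 < mu" and "mu < 1 / (spectral_norm A)\<^sup>2"
    and "\<And>n. x (Suc n) = half_threshold (lam * mu) (x n - mu *\<^sub>R (transpose A *v (A *v x n - y)))"
    and "x \<longlonglongrightarrow> xs"
    and "I = supp xs" and "I \<noteq> {}"
    and "e = Min ((\<lambda>i. \<bar>xs $ i\<bar>) ` I)"
    and "(sigma_min_gram A I > 0 \<and> 0 < lam \<and> lam < 8 * e powr (3 / 2) * sigma_min_gram A I) \<or>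
         (sigma_min_gram A I > (spectral_norm A)\<^sup>2 / 4 \<and>
          1 / (4 * sigma_min_gram A I) < mu \<and> mu < 1 / (spectral_norm A)\<^sup>2)"
  shows "\<exists>n0 > (0::nat). \<exists>\<rho>. 0 < \<rho> \<and> \<rho> < 1 \<and>
           (\<forall>n > n0. norm (x (Suc n) - xs) \<le> \<rho> * norm (x n - xs))"
proof -
  define t where "t = lam * mu"
  define \<sigma> where "\<sigma> = sigma_min_gram A I"
  define z where "z = (\<lambda>v. v - mu *\<^sub>R (transpose A *v (A *v v - y)))"
  have t: "t > 0" using assms by (simp add: t_def)
  have step: "x (Suc n) $ i = half_h t (z (x n) $ i)" for n i
    using assms(4) by (simp add: half_threshold_def t_def z_def)
  have lim: "(\<lambda>n. x n $ i) \<longlonglongrightarrow> xs $ i" for i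
    using assms(5) by (rule tendsto_vec_nth)
  have limS: "(\<lambda>n. x (Suc n) $ i) \<longlonglongrightarrow> xs $ i" for i
    using lim by (rule LIMSEQ_Suc)
  have "continuous_on UNIV z"
    unfolding z_def
    by (intro continuous_intros matrix_vector_mult_linear_continuous_on
        continuous_on_compose2[OF matrix_vector_mult_linear_continuous_on[of UNIV "transpose A"]]) auto
  then have "(\<lambda>n. z (x n)) \<longlonglongrightarrow> z xs"
    using assms(5) by (intro continuous_on_tendsto_compose[of UNIV z x xs]) auto
  then have limz: "(\<lambda>n. z (x n) $ i) \<longlonglongrightarrow> z xs $ i" for i
    by (rule tendsto_vec_nth)

  \<comment> \<open>The gap, and the eventual supports and signs\<close>
  define \<delta> where "\<delta> = root 3 (t / 2)"
  \<comment> \<open>Hence \<open>\<delta>\<^sup>2\<close> is the cube root of the gap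
    \<open>t\<^sup>2 / 4\<close>.\<close>
  have dp: "\<delta> > 0" and d3: "\<delta> ^ 3 = t / 2" using t by (auto simp: \<delta>_def)
  have gap: "\<delta>\<^sup>2 \<le> \<bar>x (Suc n) $ i\<bar>" if "x (Suc n) $ i \<noteq> 0" for n i
  proof -
    have "t\<^sup>2 / 4 \<le> \<bar>x (Suc n) $ i\<bar> ^ 3"
      using half_h_nonzero(1)[OF t] that by (simp add: step)
    moreover have "(\<delta>\<^sup>2) ^ 3 = t\<^sup>2 / 4"
    proof -
      have "(\<delta>\<^sup>2) ^ 3 = (\<delta> ^ 3)\<^sup>2" by (simp flip: power_mult)
      then show ?thesis by (simp add: d3 power_divide)
    qed
    ultimately show ?thesis by (intro power_le_imp_le_base[of "\<delta>\<^sup>2" 2]) (auto simp: eval_nat_numeral)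
  qed
  \<comment> \<open>These entries tend to \<open>0\<close>, while nonzero ones stay at least
    \<open>\<delta>\<^sup>2\<close> in modulus.\<close>
  have outside: "\<forall>\<^sub>F n in sequentially. x n $ i = 0" if "i \<notin> I" for i
  proof -
    have "xs $ i = 0" using that assms(6) by (simp add: supp_def)
    then have "(\<lambda>n. \<bar>x (Suc n) $ i\<bar>) \<longlonglongrightarrow> 0" using limS[of i] tendsto_rabs_zero by metis
    then have "\<forall>\<^sub>F n in sequentially. \<bar>x (Suc n) $ i\<bar> < \<delta>\<^sup>2"
      using dp by (intro order_tendstoD(2)) auto
    then have "\<forall>\<^sub>F n in sequentially. x (Suc n) $ i = 0"
      by eventually_elim (use gap in force)
    then show ?thesis using eventually_sequentially_Suc[of "\<lambda>n. x n $ i = 0"] by simp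
  qed
  have inside: "\<forall>\<^sub>F n in sequentially. sgn (x (Suc n) $ i) = sgn (xs $ i)" if "i \<in> I" for i
  proof (cases "xs $ i > 0")
    case True
    then show ?thesis using order_tendstoD(1)[OF limS True]
      by (auto elim: eventually_mono)
  next
    case False
    then have neg: "xs $ i < 0" using that assms(6) by (auto simp: supp_def)
    then show ?thesis using order_tendstoD(2)[OF limS neg]
      by (auto elim: eventually_mono)
  qed
  have resolvent: "\<forall>\<^sub>F n in sequentially. half_resolvent t (x (Suc n) $ i) = z (x n) $ i"
    if "i \<in> I" for i
    using inside[OF that]
  proof eventually_elim
    case (elim n)
    then have "x (Suc n) $ i \<noteq> 0" using that assms(6) by (auto simp: supp_def sgn_eq_0_iff)
    then show ?case using half_h_nonzero(2)[OF t] by (simp add: step)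
  qed
  \<comment> \<open>\<open>half_h\<close> jumps at the threshold, so the limit is taken in the
    inverse equation, which is continuous away from \<open>0\<close>.\<close>
  have resolvent_lim: "half_resolvent t (xs $ i) = z xs $ i" if "i \<in> I" for i
  proof -
    have "xs $ i \<noteq> 0" using that assms(6) by (simp add: supp_def)
    from tendsto_half_resolvent[OF limS this]
    have "(\<lambda>n. z (x n) $ i) \<longlonglongrightarrow> half_resolvent t (xs $ i)"
      by (rule Lim_transform_eventually) (rule resolvent[OF that])
    then show ?thesis using limz LIMSEQ_unique by blast
  qed
  have gap_lim: "\<delta>\<^sup>2 \<le> \<bar>xs $ i\<bar>" if "i \<in> I" for i
  proof -
    have "\<forall>\<^sub>F n in sequentially. \<delta>\<^sup>2 \<le> \<bar>x (Suc n) $ i\<bar>"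
      using inside[OF that]
    proof eventually_elim
      case (elim n)
      then have "x (Suc n) $ i \<noteq> 0" using that assms(6) by (auto simp: supp_def sgn_eq_0_iff)
      then show ?case by (rule gap)
    qed
    then show ?thesis
      by (intro tendsto_lowerbound[OF tendsto_rabs[OF limS]]) auto
  qed
  have e_le: "e \<le> \<bar>xs $ i\<bar>" if "i \<in> I" for i using that assms(8) by simp
  have "e > 0"
  proof -
    have "e \<in> (\<lambda>i. \<bar>xs $ i\<bar>) ` I" unfolding assms(8) using assms(7) by (intro Min_in) auto
    then show ?thesis using assms(6) by (auto simp: supp_def)
  qed

  \<comment> \<open>The choice of the lower bound for the moduli on the support\<close>
  obtain r where r: "r > 0" "t / (8 * r ^ 3) < mu * \<sigma>"
    and r_lim: "\<And>i. i \<in> I \<Longrightarrow> r\<^sup>2 \<le> \<bar>xs $ i\<bar>"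
    and r_ev: "\<And>i. i \<in> I \<Longrightarrow> \<forall>\<^sub>F n in sequentially. r\<^sup>2 \<le> \<bar>x (Suc n) $ i\<bar>"
  proof -
    from assms(9) consider
      "lam < 8 * e powr (3 / 2) * \<sigma>" "\<sigma> > 0"
      | "\<sigma> > (spectral_norm A)\<^sup>2 / 4" "1 / (4 * \<sigma>) < mu"
      by (auto simp: \<sigma>_def)
    then show thesis
    proof cases
      case 1
      \<comment> \<open>The strict first condition survives slightly to the left of
        \<open>sqrt e\<close>. Having \<open>r\<^sup>2 < e\<close> leaves room for iterates that
        approach the limit from below in modulus.\<close>
      have "((\<lambda>r. 8 * r ^ 3 * \<sigma>) \<longlongrightarrow> 8 * sqrt e ^ 3 * \<sigma>) (at_left (sqrt e))"
        by (intro tendsto_intros)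
      moreover have "lam < 8 * sqrt e ^ 3 * \<sigma>"
        using 1 \<open>e > 0\<close> by (simp add: powr_three_halves)
      ultimately have "\<forall>\<^sub>F r in at_left (sqrt e). lam < 8 * r ^ 3 * \<sigma>"
        by (rule order_tendstoD(1))
      moreover have "\<forall>\<^sub>F r in at_left (sqrt e). r \<in> {0<..<sqrt e}"
        using \<open>e > 0\<close> by (intro eventually_at_left_real) auto
      ultimately have "\<forall>\<^sub>F r in at_left (sqrt e). lam < 8 * r ^ 3 * \<sigma> \<and> r \<in> {0<..<sqrt e}"
        by (rule eventually_conj)
      then obtain r where r: "lam < 8 * r ^ 3 * \<sigma>" "0 < r" "r < sqrt e"
        using eventually_happens'[OF trivial_limit_at_left_real] by auto
      have "r\<^sup>2 < (sqrt e)\<^sup>2" using r by (intro power_strict_mono) auto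
      then have re: "r\<^sup>2 < e" using \<open>e > 0\<close> by simp
      show thesis
      proof (rule that[of r])
        show "t / (8 * r ^ 3) < mu * \<sigma>"
          using r assms(2) by (simp add: t_def field_simps)
        show "r\<^sup>2 \<le> \<bar>xs $ i\<bar>" if "i \<in> I" for i using e_le[OF that] re by simp
        show "\<forall>\<^sub>F n in sequentially. r\<^sup>2 \<le> \<bar>x (Suc n) $ i\<bar>" if "i \<in> I" for i
        proof -
          have "r\<^sup>2 < \<bar>xs $ i\<bar>" using e_le[OF that] re by simp
          from order_tendstoD(1)[OF tendsto_rabs[OF limS] this] show ?thesis
            by (auto elim: eventually_mono)
        qed
      qed (use r in auto)
    next
      case 2
      have "0 \<le> (spectral_norm A)\<^sup>2 / 4" by simp
      then have s: "\<sigma> > 0" using 2(1) by linarith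
      show thesis
      \<comment> \<open>Since \<open>8 * \<delta> ^ 3 = 4 * t\<close>, the requirement reads
        \<open>1 / 4 < mu * \<sigma>\<close>, which is the second condition.\<close>
      proof (rule that[of \<delta>])
        show "t / (8 * \<delta> ^ 3) < mu * \<sigma>"
          using 2(2) s t by (simp add: d3 field_simps)
        show "\<forall>\<^sub>F n in sequentially. \<delta>\<^sup>2 \<le> \<bar>x (Suc n) $ i\<bar>" if "i \<in> I" for i
          using inside[OF that]
        proof eventually_elim
          case (elim n)
          then have "x (Suc n) $ i \<noteq> 0" using that assms(6) by (auto simp: supp_def sgn_eq_0_iff)
          then show ?case by (rule gap)
        qed
      qed (use dp gap_lim in auto)
    qed
  qed

  \<comment> \<open>Contraction of the error\<close>
  define c where "c = 1 - t / (8 * r ^ 3)"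
  define k where "k = 1 - mu * \<sigma>"
  have k0: "k \<ge> 0"
    using gradient_step_contraction(1)[OF assms(2,3,7)] by (simp add: k_def \<sigma>_def)
  \<comment> \<open>Together with \<open>k0\<close> this also makes \<open>c\<close> positive, so
    that \<open>k / c\<close> lies in \<open>[0, 1)\<close>.\<close>
  have kc: "k < c" using r by (simp add: k_def c_def)
  have "\<forall>\<^sub>F n in sequentially. \<forall>i. i \<notin> I \<longrightarrow> x n $ i = 0"
    by (intro eventually_all_finite) (auto intro: outside eventually_mono)
  moreover from this have "\<forall>\<^sub>F n in sequentially. \<forall>i. i \<notin> I \<longrightarrow> x (Suc n) $ i = 0"
    by (subst eventually_sequentially_Suc)
  moreover have "\<forall>\<^sub>F n in sequentially. \<forall>i. i \<in> I \<longrightarrow> sgn (x (Suc n) $ i) = sgn (xs $ i)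
      \<and> half_resolvent t (x (Suc n) $ i) = z (x n) $ i \<and> r\<^sup>2 \<le> \<bar>x (Suc n) $ i\<bar>"
    by (intro eventually_all_finite)
      (auto simp: eventually_conj_iff intro: inside resolvent r_ev)
  ultimately have "\<forall>\<^sub>F n in sequentially. c * norm (x (Suc n) - xs) \<le> k * norm (x n - xs)"
  proof eventually_elim
    case (elim n)
    define d where "d = x n - xs"
    define g where "g = d - mu *\<^sub>R (transpose (cols_submatrix A I) *v (A *v d))"
    have xs0: "xs $ i = 0" if "i \<notin> I" for i using that assms(6) by (simp add: supp_def)
    have "supp d \<subseteq> I" using elim(1) xs0 by (force simp: supp_def d_def)
    then have ng: "norm g \<le> k * norm d"
      unfolding g_def k_def \<sigma>_def by (rule gradient_step_contraction(2)[OF assms(2,3,7)])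
    \<comment> \<open>On \<open>I\<close> the expansion of \<open>half_resolvent\<close> compares
      the entries; off \<open>I\<close> the left side is zero.\<close>
    have "norm (c *\<^sub>R (x (Suc n) - xs)) \<le> norm g"
    proof (rule norm_le_componentwise_cart)
      fix i
      show "norm ((c *\<^sub>R (x (Suc n) - xs)) $ i) \<le> norm (g $ i)"
      proof (cases "i \<in> I")
        case True
        have "z (x n) - z xs = d - mu *\<^sub>R (transpose A *v (A *v d))"
          by (simp add: z_def d_def matrix_vector_mult_diff_distrib algebra_simps)
        then have "z (x n) $ i - z xs $ i = g $ i"
          using True by (metis (no_types) g_def transpose_cols_submatrix_nth
              vector_minus_component vector_scaleR_component)
        moreover have "c * \<bar>x (Suc n) $ i - xs $ i\<bar>
            \<le> \<bar>half_resolvent t (x (Suc n) $ i) - half_resolvent t (xs $ i)\<bar>"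
          unfolding c_def
          by (rule half_resolvent_expanding) (use t r r_lim elim(3) True in auto)
        moreover have "half_resolvent t (x (Suc n) $ i) = z (x n) $ i" using elim(3) True by blast
        ultimately show ?thesis
          using resolvent_lim[OF True] k0 kc by (simp add: abs_mult)
      next
        case False
        then show ?thesis using elim(2) xs0 by simp
      qed
    qed
    then show ?case using ng k0 kc by (simp add: d_def)
  qed
  then obtain n0 where n0: "\<And>n. n \<ge> n0 \<Longrightarrow> c * norm (x (Suc n) - xs) \<le> k * norm (x n - xs)"
    by (auto simp: eventually_sequentially)
  \<comment> \<open>The maximum keeps \<open>\<rho>\<close> positive when
    \<open>k = 0\<close>.\<close>
  define \<rho> where "\<rho> = max (1 / 2) (k / c)"
  have "norm (x (Suc n) - xs) \<le> \<rho> * norm (x n - xs)" if "n > Suc n0" for n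
  proof -
    have "norm (x (Suc n) - xs) \<le> (k / c) * norm (x n - xs)"
      using n0[of n] that k0 kc by (simp add: field_simps)
    also have "\<dots> \<le> \<rho> * norm (x n - xs)" by (intro mult_right_mono) (auto simp: \<rho>_def)
    finally show ?thesis .
  qed
  moreover have "0 < \<rho>" "\<rho> < 1" using k0 kc by (auto simp: \<rho>_def)
  \<comment> \<open>The successor makes the starting index positive even if
    \<open>n0 = 0\<close>.\<close>
  ultimately show ?thesis by (intro exI[of _ "Suc n0"]) auto
qed

end
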